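(* Let $M\in\{\mathbb{R},S^1\}$ and let $k$ be a positive integer. Then $$\mathcal{D}(M;k)=\bigcup\{\mathcal{D}(M;k,\beta)\mid \beta\text{ is a concave modulus}\}=\bigcup\{\mathcal{D}(M;k,\gamma)\mid \gamma\text{ is a sup-tame concave modulus}\}.$$ Moreover, for each family of concave moduli $\mathcal{F}_0$, there exists another family $\mathcal{F}$ of concave moduli such that $$\bigcap\{\mathcal{D}(M;k,\mu)\mid \mu\in\mathcal{F}_0\}=\bigcup\{\mathcal{D}(M;k,\nu)\mid \nu\in\mathcal{F}\}.$$
   Context: A concave modulus is a homeomorphism $\alpha:[0,\infty)\to[0,\infty)$ that is concave as a function. It is sup-tame if $\lim_{t\to 0+}\sup_{x>0} t\alpha(x)/\alpha(tx)=0$. A map $f$ between metric spaces is $\alpha$-continuous if $\sup_{x\ne y} d(f(x),f(y))/\alpha(d(x,y))<\infty$, and locally $\alpha$-continuous if every point has a neighborhood on which $f$ is $\alpha$-continuous. A $C^k$ map between one-manifolds is $C^{k,\alpha}$ if its $k$-th derivative (in local coordinates) is locally $\alpha$-continuous. $\mathcal{D}(\mathbb{R};k)$ (resp. $\mathcal{D}(\mathbb{R};k,\alpha)$) is the group of compactly supported orientation preserving $C^k$ (resp. $C^{k,\alpha}$) diffeomorphisms of $\mathbb{R}$; $\mathcal{D}(S^1;k)$ (resp. $\mathcal{D}(S^1;k,\alpha)$) is the group of orientation preserving $C^k$ (resp. $C^{k,\alpha}$) diffeomorphisms of $S^1$. *)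

theory Defs
  imports "HOL-Analysis.Analysis"
begin

section \<open>Concave moduli\<close>

text \<open>A modulus is represented by a total function on the reals, of which only the
  restriction to \<open>{0..}\<close> matters.\<close>

definition concave_modulus :: "(real \<Rightarrow> real) \<Rightarrow> bool" where
  "concave_modulus \<alpha> \<longleftrightarrow>
     (\<exists>\<alpha>'. homeomorphism {0..} {0..} \<alpha> \<alpha>') \<and> concave_on {0..} \<alpha>"

text \<open>The supremum is taken in the extended reals, so that it is never a junk value.\<close>

definition sup_tame :: "(real \<Rightarrow> real) \<Rightarrow> bool" where
  "sup_tame \<alpha> \<longleftrightarrow>
     ((\<lambda>t. SUP x\<in>{0<..}. ereal (t * \<alpha> x / \<alpha> (t * x))) \<longlongrightarrow> 0) (at_right 0)"

definition modulus_continuous_on ::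
    "(real \<Rightarrow> real) \<Rightarrow> 'a::metric_space set \<Rightarrow> ('a \<Rightarrow> 'b::metric_space) \<Rightarrow> bool" where
  "modulus_continuous_on \<alpha> S f \<longleftrightarrow>
     bdd_above {dist (f x) (f y) / \<alpha> (dist x y) | x y. x \<in> S \<and> y \<in> S \<and> x \<noteq> y}"

definition locally_modulus_continuous_on ::
    "(real \<Rightarrow> real) \<Rightarrow> 'a::metric_space set \<Rightarrow> ('a \<Rightarrow> 'b::metric_space) \<Rightarrow> bool" where
  "locally_modulus_continuous_on \<alpha> S f \<longleftrightarrow>
     (\<forall>x\<in>S. \<exists>V. open V \<and> x \<in> V \<and> modulus_continuous_on \<alpha> (S \<inter> V) f)"


section \<open>Regularity of real functions on open sets\<close>

text \<open>Only used for open \<open>U\<close>, where the iterated \<open>deriv\<close> depends only on \<open>g\<close> restricted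
  to \<open>U\<close>.\<close>

definition Ck_on :: "nat \<Rightarrow> real set \<Rightarrow> (real \<Rightarrow> real) \<Rightarrow> bool" where
  "Ck_on k U g \<longleftrightarrow>
     (\<forall>j<k. \<forall>t\<in>U. (deriv ^^ j) g field_differentiable at t) \<and>
     continuous_on U ((deriv ^^ k) g)"

definition Ck_mod_on :: "nat \<Rightarrow> (real \<Rightarrow> real) \<Rightarrow> real set \<Rightarrow> (real \<Rightarrow> real) \<Rightarrow> bool" where
  "Ck_mod_on k \<alpha> U g \<longleftrightarrow>
     Ck_on k U g \<and> locally_modulus_continuous_on \<alpha> U ((deriv ^^ k) g)"


section \<open>Maps of oriented one-manifolds in local coordinates\<close>

text \<open>An oriented one-manifold is a subset \<open>M\<close> of a topological space together with an atlas
  given by inverse charts: pairs \<open>(I, p)\<close> of an open set \<open>I\<close> of reals and a homeomorphism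
  \<open>p\<close> from \<open>I\<close> onto a relatively open subset of \<open>M\<close>, these subsets covering \<open>M\<close>. The
  coordinate on \<open>p ` I\<close> is thus \<open>inv_into I p\<close>.\<close>

type_synonym 'a atlas = "(real set \<times> (real \<Rightarrow> 'a)) set"

definition real_atlas :: "real atlas" where
  "real_atlas = {(UNIV, id)}"

text \<open>The circle is the unit circle in the complex plane, with the angle coordinates. Their
  transition functions are locally translations by multiples of \<open>2 * pi\<close>.\<close>

abbreviation circle :: "complex set" where
  "circle \<equiv> sphere 0 1"

definition circle_atlas :: "complex atlas" where
  "circle_atlas = {({\<theta> - pi <..< \<theta> + pi}, cis) | \<theta>. True}"

text \<open>The expression of \<open>f\<close> in the coordinates \<open>(I, p)\<close> on the source and \<open>(J, q)\<close> on the
  target, and the set of coordinates where this expression makes sense.\<close>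

definition local_dom ::
    "real set \<times> (real \<Rightarrow> 'a) \<Rightarrow> real set \<times> (real \<Rightarrow> 'a) \<Rightarrow> ('a \<Rightarrow> 'a) \<Rightarrow> real set" where
  "local_dom c d f = {t \<in> fst c. f (snd c t) \<in> snd d ` fst d}"

definition local_rep ::
    "real set \<times> (real \<Rightarrow> 'a) \<Rightarrow> real set \<times> (real \<Rightarrow> 'a) \<Rightarrow> ('a \<Rightarrow> 'a) \<Rightarrow> real \<Rightarrow> real" where
  "local_rep c d f = inv_into (fst d) (snd d) \<circ> f \<circ> snd c"

definition Ck_map :: "'a::topological_space set \<Rightarrow> 'a atlas \<Rightarrow> nat \<Rightarrow> ('a \<Rightarrow> 'a) \<Rightarrow> bool" where
  "Ck_map M A k f \<longleftrightarrow> f \<in> M \<rightarrow> M \<and> continuous_on M f \<and>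
     (\<forall>c\<in>A. \<forall>d\<in>A. Ck_on k (local_dom c d f) (local_rep c d f))"

definition Ck_mod_map ::
    "'a::topological_space set \<Rightarrow> 'a atlas \<Rightarrow> nat \<Rightarrow> (real \<Rightarrow> real) \<Rightarrow> ('a \<Rightarrow> 'a) \<Rightarrow> bool" where
  "Ck_mod_map M A k \<alpha> f \<longleftrightarrow> f \<in> M \<rightarrow> M \<and> continuous_on M f \<and>
     (\<forall>c\<in>A. \<forall>d\<in>A. Ck_mod_on k \<alpha> (local_dom c d f) (local_rep c d f))"

text \<open>Meaningful for \<open>C\<^sup>1\<close> diffeomorphisms.\<close>

definition orientation_preserving :: "'a atlas \<Rightarrow> ('a \<Rightarrow> 'a) \<Rightarrow> bool" where
  "orientation_preserving A f \<longleftrightarrow>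
     (\<forall>c\<in>A. \<forall>d\<in>A. \<forall>t\<in>local_dom c d f. 0 < deriv (local_rep c d f) t)"


section \<open>Diffeomorphism groups\<close>

text \<open>The elements are required to be \<open>extensional\<close>, so that two diffeomorphisms are equal as
  HOL functions iff they agree on \<open>M\<close>.\<close>

definition diffeos :: "'a::topological_space set \<Rightarrow> 'a atlas \<Rightarrow> nat \<Rightarrow> ('a \<Rightarrow> 'a) set" where
  "diffeos M A k = {f \<in> extensional M. bij_betw f M M \<and>
     Ck_map M A k f \<and> Ck_map M A k (inv_into M f) \<and> orientation_preserving A f}"

definition diffeos_mod ::
    "'a::topological_space set \<Rightarrow> 'a atlas \<Rightarrow> nat \<Rightarrow> (real \<Rightarrow> real) \<Rightarrow> ('a \<Rightarrow> 'a) set" where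
  "diffeos_mod M A k \<alpha> = {f \<in> extensional M. bij_betw f M M \<and>
     Ck_mod_map M A k \<alpha> f \<and> Ck_mod_map M A k \<alpha> (inv_into M f) \<and> orientation_preserving A f}"

definition compactly_supported :: "('a::topological_space \<Rightarrow> 'a) \<Rightarrow> bool" where
  "compactly_supported f \<longleftrightarrow> compact (closure {x. f x \<noteq> x})"

definition D_real :: "nat \<Rightarrow> (real \<Rightarrow> real) set" where
  "D_real k = {f \<in> diffeos UNIV real_atlas k. compactly_supported f}"

definition D_real_mod :: "nat \<Rightarrow> (real \<Rightarrow> real) \<Rightarrow> (real \<Rightarrow> real) set" where
  "D_real_mod k \<alpha> = {f \<in> diffeos_mod UNIV real_atlas k \<alpha>. compactly_supported f}"

definition D_circle :: "nat \<Rightarrow> (complex \<Rightarrow> complex) set" where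
  "D_circle k = diffeos circle circle_atlas k"

definition D_circle_mod :: "nat \<Rightarrow> (real \<Rightarrow> real) \<Rightarrow> (complex \<Rightarrow> complex) set" where
  "D_circle_mod k \<alpha> = diffeos_mod circle circle_atlas k \<alpha>"

lemma diffeos_mod_subset: "diffeos_mod M A k \<alpha> \<subseteq> diffeos M A k"
  by (auto simp: diffeos_mod_def diffeos_def Ck_mod_map_def Ck_map_def Ck_mod_on_def)

text \<open>Hence, for a nonempty family of moduli, intersecting the groups \<open>D_real_mod k \<mu>\<close> inside
  \<open>D_real k\<close> is the same as just intersecting them; for the empty family the result is
  \<open>D_real k\<close>. Likewise for the circle.\<close>

lemma D_real_mod_subset: "D_real_mod k \<alpha> \<subseteq> D_real k"
  using diffeos_mod_subset by (fastforce simp: D_real_mod_def D_real_def)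

lemma D_circle_mod_subset: "D_circle_mod k \<alpha> \<subseteq> D_circle k"
  unfolding D_circle_mod_def D_circle_def by (rule diffeos_mod_subset)

lemma Ck_map_real_iff: "Ck_map UNIV real_atlas k f \<longleftrightarrow> Ck_on k UNIV f"
proof -
  have rep: "local_rep (UNIV, id) (UNIV, id) f = f" and
       dom: "local_dom (UNIV, id) (UNIV, id) f = UNIV"
    by (simp_all add: local_rep_def local_dom_def fun_eq_iff)
  have "continuous_on UNIV f" if "Ck_on k UNIV f"
  proof (cases k)
    case 0
    with that show ?thesis by (simp add: Ck_on_def)
  next
    case (Suc n)
    with that have "\<forall>t. f field_differentiable at t"
      unfolding Ck_on_def by (metis UNIV_I funpow_0 zero_less_Suc)
    then show ?thesis
      by (simp add: continuous_at_imp_continuous_on field_differentiable_imp_continuous_at)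
  qed
  then show ?thesis
    by (auto simp: Ck_map_def real_atlas_def rep dom)
qed

end

theory Submission
  imports Defs
begin

text \<open>
  Whether a \<open>C\<^sup>k\<close> diffeomorphism \<open>f\<close> is \<open>C\<^sup>k\<^sup>,\<^sup>\<alpha>\<close> depends only on the local \<open>\<alpha>\<close>-continuity of one
  continuous function \<open>H\<close> on the line, the pair of the \<open>k\<close>-th derivatives of \<open>f\<close> and of its inverse.
  On the circle these derivatives are functions of the angle: angle charts differ by translations,
  so that for \<open>k > 0\<close> the derivative does not depend on the charts
  (\<open>higher_deriv_angle_chart_independent\<close>). By compactness of the support or of the circle, every
  interval of radius one looks, for \<open>H\<close>, like an interval centred in a fixed compact one
  (\<open>compactly_modelled\<close>). Hence \<open>H\<close> is bounded and uniformly continuous, and local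
  \<open>\<alpha>\<close>-continuity of \<open>H\<close> is the same as global \<open>\<alpha>\<close>-continuity
  (\<open>compactly_modelled_global_modulus\<close>).

  Such an \<open>H\<close> has an optimal concave modulus \<open>\<nu>\<close>, the least concave majorant of its modulus of
  continuity plus the identity: \<open>H\<close> is \<open>\<nu>\<close>-continuous, and if \<open>H\<close> is \<open>\<mu>\<close>-continuous for a concave
  modulus \<open>\<mu>\<close>, then \<open>\<nu> \<le> C * \<mu>\<close> near zero for some constant \<open>C\<close> (\<open>exists_optimal_modulus\<close>). This shows
  that each diffeomorphism has a concave modulus. The square root of \<open>\<nu>\<close> is sup-tame and dominates
  \<open>\<nu>\<close> near zero, so the modulus can be taken sup-tame. Finally, if \<open>f\<close> lies in the classes of all
  members \<open>\<mu>\<close> of a family, then the whole class of its optimal modulus \<open>\<nu>\<close> does, since \<open>\<nu>\<close> is dominated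
  by each \<open>\<mu>\<close>; the intersection is therefore the union of all the classes that it contains
  (\<open>regularity_classes\<close>).
\<close>

section \<open>Concave moduli\<close>

lemma concave_modulus_mono:
  assumes "concave_modulus \<alpha>" "0 \<le> x" "x \<le> y"
  shows "\<alpha> x \<le> \<alpha> y"
proof (rule ccontr)
  obtain \<alpha>' where h: "homeomorphism {0..} {0..} \<alpha> \<alpha>'" and c: "concave_on {0..} \<alpha>"
    using assms(1) by (auto simp: concave_modulus_def)
  assume "\<not> \<alpha> x \<le> \<alpha> y"
  then have less: "\<alpha> y < \<alpha> x" and xy: "x < y"
    using assms(3) by (auto simp: order.order_iff_strict)
  \<comment> \<open>A concave function that decreases somewhere becomes negative far to the right, at \<open>z\<close>.\<close>
  define z where "z = max (y + 1) ((y * \<alpha> x - x * \<alpha> y) / (\<alpha> x - \<alpha> y) + 1)"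
  have zy: "y < z" and "(y * \<alpha> x - x * \<alpha> y) / (\<alpha> x - \<alpha> y) < z"
    unfolding z_def by linarith+
  then have z: "y * \<alpha> x - x * \<alpha> y < z * (\<alpha> x - \<alpha> y)"
    using less by (simp add: pos_divide_less_eq)
  have "0 \<le> \<alpha> z"
    using h assms zy unfolding homeomorphism_def by force
  have "0 \<le> (z - y) / (z - x)" "0 \<le> (y - x) / (z - x)" "(z - y) / (z - x) + (y - x) / (z - x) = 1"
    using xy zy by (simp_all add: divide_simps)
  then have "(z - y) / (z - x) * \<alpha> x + (y - x) / (z - x) * \<alpha> z
      \<le> \<alpha> (((z - y) / (z - x)) *\<^sub>R x + ((y - x) / (z - x)) *\<^sub>R z)"
    using c assms(2) xy zy unfolding concave_on_iff
    by (metis atLeast_iff less_imp_le order_trans)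
  also have "((z - y) / (z - x)) *\<^sub>R x + ((y - x) / (z - x)) *\<^sub>R z = y"
    using xy zy by (simp add: divide_simps) (simp add: algebra_simps)
  finally have "(z - y) / (z - x) * \<alpha> x + (y - x) / (z - x) * \<alpha> z \<le> \<alpha> y" .
  moreover have "0 \<le> (y - x) / (z - x) * \<alpha> z"
    using \<open>0 \<le> \<alpha> z\<close> xy zy by simp
  ultimately have "(z - y) / (z - x) * \<alpha> x \<le> \<alpha> y"
    by linarith
  then have "(z - y) * \<alpha> x \<le> \<alpha> y * (z - x)"
    using xy zy by (simp add: divide_simps)
  with z show False
    by (simp add: algebra_simps)
qed

lemma concave_modulus_0:
  assumes "concave_modulus \<alpha>"
  shows "\<alpha> 0 = 0"
proof -
  obtain \<alpha>' where h: "homeomorphism {0..} {0..} \<alpha> \<alpha>'"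
    using assms by (auto simp: concave_modulus_def)
  then have im: "\<alpha> ` {0..} = {0..}"
    by (simp add: homeomorphism_def)
  then obtain z where "0 \<le> z" "\<alpha> z = 0"
    by (metis (no_types, lifting) atLeast_iff imageE order_refl)
  then have "\<alpha> 0 \<le> 0"
    using concave_modulus_mono[OF assms, of 0 z] by simp
  moreover have "0 \<le> \<alpha> 0"
    using im by force
  ultimately show ?thesis by simp
qed

lemma concave_modulus_pos:
  assumes "concave_modulus \<alpha>" "0 < t"
  shows "0 < \<alpha> t"
proof -
  obtain \<alpha>' where h: "homeomorphism {0..} {0..} \<alpha> \<alpha>'"
    using assms by (auto simp: concave_modulus_def)
  then have "\<alpha> t \<noteq> \<alpha> 0"
    using assms(2) unfolding homeomorphism_def by (metis atLeast_iff less_imp_le less_irrefl order_refl)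
  with concave_modulus_mono[OF assms(1), of 0 t] concave_modulus_0[OF assms(1)] assms(2)
  show ?thesis by simp
qed

lemma concave_modulus_scale:
  assumes "concave_modulus \<alpha>" "0 \<le> t" "t \<le> 1" "0 \<le> x"
  shows "t * \<alpha> x \<le> \<alpha> (t * x)"
proof -
  have "concave_on {0..} \<alpha>"
    using assms by (auto simp: concave_modulus_def)
  then have "(1 - t) * \<alpha> 0 + t * \<alpha> x \<le> \<alpha> ((1 - t) *\<^sub>R 0 + t *\<^sub>R x)"
    by (rule concave_onD) (use assms in auto)
  then show ?thesis
    by (simp add: concave_modulus_0[OF assms(1)])
qed

lemma concave_modulusI:
  fixes \<nu> :: "real \<Rightarrow> real"
  assumes "concave_on {0..} \<nu>" "continuous_on {0..} \<nu>" "strict_mono_on {0..} \<nu>" "\<nu> 0 = 0"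
    and unbounded: "\<And>B. \<exists>t\<ge>0. B \<le> \<nu> t"
  shows "concave_modulus \<nu>"
proof -
  have "\<nu> ` {0..} = {0..}"
  proof
    show "\<nu> ` {0..} \<subseteq> {0..}"
      using strict_mono_on_leD[OF assms(3)] assms(4) by force
    show "{0..} \<subseteq> \<nu> ` {0..}"
    proof
      fix s :: real assume "s \<in> {0..}"
      then have s: "0 \<le> s" by simp
      obtain t where t: "0 \<le> t" "s \<le> \<nu> t"
        using unbounded by blast
      have "continuous_on {0..t} \<nu>"
        using assms(2) by (rule continuous_on_subset) auto
      then obtain x where "0 \<le> x" "\<nu> x = s"
        using IVT'[of \<nu> 0 s t] s t assms(4) by auto
      then show "s \<in> \<nu> ` {0..}" by auto
    qed
  qed
  moreover have "inj_on \<nu> {0..}"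
    using assms(3) by (rule strict_mono_on_imp_inj_on)
  ultimately have "\<exists>g. homeomorphism {0..} {0..} \<nu> g"
    using assms(2) by (intro homeomorphism_into_1d) (auto simp: is_interval_path_connected)
  with assms(1) show ?thesis
    by (simp add: concave_modulus_def)
qed

lemma concave_modulus_sqrt:
  assumes "concave_modulus \<nu>"
  shows "concave_modulus (\<lambda>t. sqrt (\<nu> t))"
proof -
  obtain \<alpha>' where h: "homeomorphism {0..} {0..} \<nu> \<alpha>'" and c: "concave_on {0..} \<nu>"
    using assms by (auto simp: concave_modulus_def)
  have nonneg: "0 \<le> \<nu> t" if "0 \<le> t" for t
    using concave_modulus_mono[OF assms, of 0 t] concave_modulus_0[OF assms] that by simp
  show ?thesis
  proof (rule concave_modulusI)
    show "concave_on {0..} (\<lambda>t. sqrt (\<nu> t))"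
      unfolding concave_on_iff
    proof (intro conjI ballI allI impI)
      fix x y u v :: real
      assume xy: "x \<in> {0..}" "y \<in> {0..}" and uv: "0 \<le> u" "0 \<le> v" "u + v = 1"
      have "(u * sqrt (\<nu> x) + v * sqrt (\<nu> y))\<^sup>2 \<le> u * \<nu> x + v * \<nu> y"
      proof -
        have v: "v = 1 - u" using uv by simp
        have "u * (sqrt (\<nu> x))\<^sup>2 + v * (sqrt (\<nu> y))\<^sup>2 - (u * sqrt (\<nu> x) + v * sqrt (\<nu> y))\<^sup>2
            = u * v * (sqrt (\<nu> x) - sqrt (\<nu> y))\<^sup>2"
          unfolding v by (simp add: power2_eq_square algebra_simps)
        moreover have "0 \<le> u * v * (sqrt (\<nu> x) - sqrt (\<nu> y))\<^sup>2"
          using uv by simp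
        ultimately show ?thesis
          using xy by (simp add: nonneg)
      qed
      also have "\<dots> \<le> \<nu> (u *\<^sub>R x + v *\<^sub>R y)"
        using c xy uv unfolding concave_on_iff by blast
      finally show "u * sqrt (\<nu> x) + v * sqrt (\<nu> y) \<le> sqrt (\<nu> (u *\<^sub>R x + v *\<^sub>R y))"
        by (rule real_le_rsqrt)
    qed auto
    show "continuous_on {0..} (\<lambda>t. sqrt (\<nu> t))"
      using h by (intro continuous_on_real_sqrt) (simp add: homeomorphism_def)
    show "strict_mono_on {0..} (\<lambda>t. sqrt (\<nu> t))"
    proof (rule strict_mono_onI)
      fix r s :: real assume rs: "r \<in> {0..}" "s \<in> {0..}" "r < s"
      then have "\<nu> r \<noteq> \<nu> s"
        using h unfolding homeomorphism_def by (metis less_irrefl)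
      then show "sqrt (\<nu> r) < sqrt (\<nu> s)"
        using concave_modulus_mono[OF assms, of r s] rs by simp
    qed
    show "sqrt (\<nu> 0) = 0"
      by (simp add: concave_modulus_0[OF assms])
    show "\<exists>t\<ge>0. B \<le> sqrt (\<nu> t)" for B
    proof -
      have "B\<^sup>2 \<in> \<nu> ` {0..}"
        using h by (simp add: homeomorphism_def)
      then obtain t where "0 \<le> t" "\<nu> t = B\<^sup>2" by auto
      then show ?thesis by (intro exI[of _ t]) simp
    qed
  qed
qed

text \<open>By concavity, \<open>t * \<nu> x \<le> \<nu> (t * x)\<close> for \<open>0 < t < 1\<close>, so that the quotient in the definition
  of sup-tameness is at most \<open>sqrt t\<close> for the square root of \<open>\<nu>\<close>.\<close>

lemma sup_tame_sqrt:
  assumes "concave_modulus \<nu>"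
  shows "sup_tame (\<lambda>t. sqrt (\<nu> t))"
proof -
  let ?S = "\<lambda>t. SUP x\<in>{0<..}. ereal (t * sqrt (\<nu> x) / sqrt (\<nu> (t * x)))"
  have pt: "t * sqrt (\<nu> x) / sqrt (\<nu> (t * x)) \<le> sqrt t" if "0 < t" "t < 1" "0 < x" for t x
  proof -
    have pos: "0 < \<nu> (t * x)"
      using concave_modulus_pos[OF assms] that by simp
    have "t * sqrt (\<nu> x) = sqrt t * sqrt (t * \<nu> x)"
      using that by (simp add: real_sqrt_mult flip: mult.assoc)
    also have "\<dots> \<le> sqrt t * sqrt (\<nu> (t * x))"
      using concave_modulus_scale[OF assms, of t x] that by (intro mult_left_mono) auto
    finally show ?thesis
      using pos by (simp add: divide_simps)
  qed
  have ev: "\<forall>\<^sub>F t in at_right 0. 0 < t \<and> t < (1::real)"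
    unfolding eventually_at_right_field by (intro exI[of _ 1]) auto
  have "((\<lambda>t. ereal (sqrt t)) \<longlongrightarrow> ereal (sqrt 0)) (at_right 0)"
    by (intro tendsto_intros)
  then have lim: "((\<lambda>t. ereal (sqrt t)) \<longlongrightarrow> 0) (at_right 0)"
    by (simp add: zero_ereal_def)
  show ?thesis
    unfolding sup_tame_def
  proof (rule tendsto_sandwich[OF _ _ tendsto_const lim])
    show "\<forall>\<^sub>F t in at_right 0. 0 \<le> ?S t"
      using ev
    proof eventually_elim
      case (elim t)
      have "0 \<le> ereal (t * sqrt (\<nu> 1) / sqrt (\<nu> (t * 1)))"
        using elim concave_modulus_pos[OF assms, of 1] concave_modulus_pos[OF assms, of t] by simp
      also have "\<dots> \<le> ?S t"
        by (rule SUP_upper) simp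
      finally show ?case .
    qed
    show "\<forall>\<^sub>F t in at_right 0. ?S t \<le> ereal (sqrt t)"
      using ev by eventually_elim (intro SUP_least, simp add: pt)
  qed
qed


section \<open>Continuity with respect to a modulus\<close>

lemma modulus_continuous_onI:
  assumes "concave_modulus \<alpha>" "\<And>x y. x \<in> S \<Longrightarrow> y \<in> S \<Longrightarrow> dist (f x) (f y) \<le> C * \<alpha> (dist x y)"
  shows "modulus_continuous_on \<alpha> S f"
  unfolding modulus_continuous_on_def
proof (rule bdd_aboveI[of _ C])
  fix r assume "r \<in> {dist (f x) (f y) / \<alpha> (dist x y) | x y. x \<in> S \<and> y \<in> S \<and> x \<noteq> y}"
  then obtain x y where xy: "x \<in> S" "y \<in> S" "x \<noteq> y" "r = dist (f x) (f y) / \<alpha> (dist x y)"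
    by blast
  then show "r \<le> C"
    using assms(2)[of x y] concave_modulus_pos[OF assms(1), of "dist x y"]
    by (simp add: pos_divide_le_eq)
qed

lemma modulus_continuous_onE:
  assumes "concave_modulus \<alpha>" "modulus_continuous_on \<alpha> S f"
  obtains C where "C \<ge> 0" "\<And>x y. x \<in> S \<Longrightarrow> y \<in> S \<Longrightarrow> dist (f x) (f y) \<le> C * \<alpha> (dist x y)"
proof -
  obtain B where B: "\<And>r. r \<in> {dist (f x) (f y) / \<alpha> (dist x y) | x y. x \<in> S \<and> y \<in> S \<and> x \<noteq> y} \<Longrightarrow> r \<le> B"
    using assms(2) unfolding modulus_continuous_on_def bdd_above_def by blast
  have "dist (f x) (f y) \<le> max B 0 * \<alpha> (dist x y)" if "x \<in> S" "y \<in> S" for x y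
  proof (cases "x = y")
    case True
    then show ?thesis by (simp add: concave_modulus_0[OF assms(1)])
  next
    case False
    then have pos: "0 < \<alpha> (dist x y)"
      using concave_modulus_pos[OF assms(1)] by simp
    have "dist (f x) (f y) / \<alpha> (dist x y) \<le> B"
      using B that False by blast
    then have "dist (f x) (f y) \<le> B * \<alpha> (dist x y)"
      using pos by (simp add: divide_simps)
    also have "\<dots> \<le> max B 0 * \<alpha> (dist x y)"
      using pos by (intro mult_right_mono) auto
    finally show ?thesis .
  qed
  then show ?thesis
    using that[of "max B 0"] by simp
qed

lemma modulus_continuous_on_subset:
  "modulus_continuous_on \<alpha> S f \<Longrightarrow> T \<subseteq> S \<Longrightarrow> modulus_continuous_on \<alpha> T f"
  unfolding modulus_continuous_on_def by (erule bdd_above_mono) blast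

lemma modulus_continuous_on_cong:
  assumes "\<And>x. x \<in> S \<Longrightarrow> f x = g x"
  shows "modulus_continuous_on \<alpha> S f \<longleftrightarrow> modulus_continuous_on \<alpha> S g"
proof -
  have "{dist (f x) (f y) / \<alpha> (dist x y) | x y. x \<in> S \<and> y \<in> S \<and> x \<noteq> y} =
        {dist (g x) (g y) / \<alpha> (dist x y) | x y. x \<in> S \<and> y \<in> S \<and> x \<noteq> y}"
    using assms by (intro Collect_cong) metis
  then show ?thesis by (simp add: modulus_continuous_on_def)
qed

lemma modulus_continuous_on_Pair:
  assumes "concave_modulus \<alpha>"
  shows "modulus_continuous_on \<alpha> S (\<lambda>x. (f x, g x)) \<longleftrightarrow>
    modulus_continuous_on \<alpha> S f \<and> modulus_continuous_on \<alpha> S g"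
proof (intro iffI conjI)
  assume "modulus_continuous_on \<alpha> S (\<lambda>x. (f x, g x))"
  then obtain C where "C \<ge> 0"
    and C: "\<And>x y. x \<in> S \<Longrightarrow> y \<in> S \<Longrightarrow> dist (f x, g x) (f y, g y) \<le> C * \<alpha> (dist x y)"
    using modulus_continuous_onE[OF assms] by blast
  show "modulus_continuous_on \<alpha> S f"
    using order_trans[OF dist_fst_le[of "(f x, g x)" "(f y, g y)" for x y] C]
    by (intro modulus_continuous_onI[OF assms]) simp
  show "modulus_continuous_on \<alpha> S g"
    using order_trans[OF dist_snd_le[of "(f x, g x)" "(f y, g y)" for x y] C]
    by (intro modulus_continuous_onI[OF assms]) simp
next
  assume "modulus_continuous_on \<alpha> S f \<and> modulus_continuous_on \<alpha> S g"
  then have mf: "modulus_continuous_on \<alpha> S f" and mg: "modulus_continuous_on \<alpha> S g"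
    by simp_all
  obtain C where C: "C \<ge> 0" "\<And>x y. x \<in> S \<Longrightarrow> y \<in> S \<Longrightarrow> dist (f x) (f y) \<le> C * \<alpha> (dist x y)"
    using modulus_continuous_onE[OF assms mf] by blast
  obtain D where D: "D \<ge> 0" "\<And>x y. x \<in> S \<Longrightarrow> y \<in> S \<Longrightarrow> dist (g x) (g y) \<le> D * \<alpha> (dist x y)"
    using modulus_continuous_onE[OF assms mg] by blast
  show "modulus_continuous_on \<alpha> S (\<lambda>x. (f x, g x))"
  proof (rule modulus_continuous_onI[OF assms])
    fix x y assume xy: "x \<in> S" "y \<in> S"
    have "dist (f x, g x) (f y, g y) \<le> dist (f x) (f y) + dist (g x) (g y)"
      unfolding dist_Pair_Pair by (rule sqrt_sum_squares_le_sum) auto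
    with C(2)[OF xy] D(2)[OF xy] show "dist (f x, g x) (f y, g y) \<le> (C + D) * \<alpha> (dist x y)"
      by (simp add: distrib_right)
  qed
qed

lemma locally_modulus_continuous_on_Pair:
  assumes "concave_modulus \<alpha>"
  shows "locally_modulus_continuous_on \<alpha> S (\<lambda>x. (f x, g x)) \<longleftrightarrow>
    locally_modulus_continuous_on \<alpha> S f \<and> locally_modulus_continuous_on \<alpha> S g"
  (is "?L \<longleftrightarrow> ?R")
proof
  assume ?L
  then show ?R
    unfolding locally_modulus_continuous_on_def modulus_continuous_on_Pair[OF assms] by blast
next
  assume R: ?R
  show ?L
    unfolding locally_modulus_continuous_on_def
  proof
    fix x assume "x \<in> S"
    with R obtain V W where
      "open V" "x \<in> V" "modulus_continuous_on \<alpha> (S \<inter> V) f"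
      "open W" "x \<in> W" "modulus_continuous_on \<alpha> (S \<inter> W) g"
      unfolding locally_modulus_continuous_on_def by meson
    then show "\<exists>V. open V \<and> x \<in> V \<and> modulus_continuous_on \<alpha> (S \<inter> V) (\<lambda>x. (f x, g x))"
      by (intro exI[of _ "V \<inter> W"])
        (auto simp: modulus_continuous_on_Pair[OF assms] elim!: modulus_continuous_on_subset)
  qed
qed

text \<open>Only the values of a modulus near zero matter.\<close>

lemma locally_modulus_continuous_on_dominated:
  fixes f :: "'a::metric_space \<Rightarrow> 'b::metric_space"
  assumes "concave_modulus \<nu>" "concave_modulus \<mu>"
    and le: "\<And>t. 0 \<le> t \<Longrightarrow> t \<le> 1 \<Longrightarrow> \<nu> t \<le> C * \<mu> t"
    and f: "locally_modulus_continuous_on \<nu> S f"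
  shows "locally_modulus_continuous_on \<mu> S f"
  unfolding locally_modulus_continuous_on_def
proof
  fix x assume "x \<in> S"
  with f obtain V where V: "open V" "x \<in> V" "modulus_continuous_on \<nu> (S \<inter> V) f"
    unfolding locally_modulus_continuous_on_def by blast
  then obtain D where D: "D \<ge> 0"
    "\<And>x y. x \<in> S \<inter> V \<Longrightarrow> y \<in> S \<inter> V \<Longrightarrow> dist (f x) (f y) \<le> D * \<nu> (dist x y)"
    using modulus_continuous_onE[OF assms(1)] by metis
  have "modulus_continuous_on \<mu> (S \<inter> (V \<inter> ball x (1/2))) f"
  proof (rule modulus_continuous_onI[OF assms(2)])
    fix y z assume yz: "y \<in> S \<inter> (V \<inter> ball x (1/2))" "z \<in> S \<inter> (V \<inter> ball x (1/2))"
    then have "dist y z \<le> 1"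
      using dist_triangle_half_l[of y x 1 z] by (simp add: dist_commute)
    have "dist (f y) (f z) \<le> D * \<nu> (dist y z)"
      using D(2) yz by blast
    also have "\<dots> \<le> D * (C * \<mu> (dist y z))"
      using D(1) le \<open>dist y z \<le> 1\<close> by (intro mult_left_mono) auto
    finally show "dist (f y) (f z) \<le> (D * C) * \<mu> (dist y z)"
      by (simp add: mult.assoc)
  qed
  with V show "\<exists>V. open V \<and> x \<in> V \<and> modulus_continuous_on \<mu> (S \<inter> V) f"
    by (intro exI[of _ "V \<inter> ball x (1/2)"]) auto
qed


section \<open>Functions modelled on a compact interval\<close>

text \<open>Up to translation, the restrictions of \<open>H\<close> to intervals of radius one all occur around a
  point of one compact interval. Periodic functions and functions that are constant near
  infinity have this property.\<close>

definition compactly_modelled :: "(real \<Rightarrow> 'a) \<Rightarrow> bool" where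
  "compactly_modelled H \<longleftrightarrow>
     (\<exists>R. \<forall>x. \<exists>y\<in>{-R..R}. \<forall>s. \<bar>s\<bar> < 1 \<longrightarrow> H (x + s) = H (y + s))"

lemma compactly_modelled_bounded:
  fixes H :: "real \<Rightarrow> 'b::metric_space"
  assumes "compactly_modelled H" "continuous_on UNIV H"
  obtains B where "B > 0" "\<And>x y. dist (H x) (H y) \<le> B"
proof -
  obtain R where R: "\<And>x. \<exists>y\<in>{-R..R}. \<forall>s. \<bar>s\<bar> < 1 \<longrightarrow> H (x + s) = H (y + s)"
    using assms(1) unfolding compactly_modelled_def by blast
  have "compact (H ` {-R..R})"
    using assms(2) by (intro compact_continuous_image) (auto intro: continuous_on_subset)
  then obtain z e where ze: "\<forall>x\<in>H ` {-R..R}. dist z x \<le> e"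
    using compact_imp_bounded unfolding bounded_def by blast
  have "dist z (H x) \<le> e" for x
  proof -
    obtain y where "y \<in> {-R..R}" "\<forall>s. \<bar>s\<bar> < 1 \<longrightarrow> H (x + s) = H (y + s)"
      using R by blast
    moreover from this have "H x = H y"
      by (metis abs_zero add.right_neutral zero_less_one)
    ultimately show ?thesis using ze by auto
  qed
  then have "dist (H x) (H y) \<le> max (2 * e) 1" for x y
    using dist_triangle3[of "H x" "H y" z] by (smt (verit))
  then show ?thesis
    using that[of "max (2 * e) 1"] by simp
qed

lemma compactly_modelled_uniformly_continuous:
  fixes H :: "real \<Rightarrow> 'b::metric_space"
  assumes "compactly_modelled H" "continuous_on UNIV H"
  shows "uniformly_continuous_on UNIV H"
  unfolding uniformly_continuous_on_def
proof (intro allI impI)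
  fix \<epsilon> :: real assume "\<epsilon> > 0"
  obtain R where R: "\<And>x. \<exists>y\<in>{-R..R}. \<forall>s. \<bar>s\<bar> < 1 \<longrightarrow> H (x + s) = H (y + s)"
    using assms(1) unfolding compactly_modelled_def by blast
  have "uniformly_continuous_on {-R-1..R+1} H"
    using assms(2) by (intro compact_uniformly_continuous) (auto intro: continuous_on_subset)
  then obtain \<delta> where \<delta>: "\<delta> > 0"
    "\<And>x x'. x \<in> {-R-1..R+1} \<Longrightarrow> x' \<in> {-R-1..R+1} \<Longrightarrow> dist x' x < \<delta> \<Longrightarrow> dist (H x') (H x) < \<epsilon>"
    using \<open>\<epsilon> > 0\<close> unfolding uniformly_continuous_on_def by meson
  have "dist (H x') (H x) < \<epsilon>" if d: "dist x' x < min \<delta> 1" for x x'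
  proof -
    obtain y where y: "y \<in> {-R..R}" "\<forall>s. \<bar>s\<bar> < 1 \<longrightarrow> H (x + s) = H (y + s)"
      using R by blast
    have "\<bar>x' - x\<bar> < 1" using d by (simp add: dist_real_def)
    with y(2)[rule_format, of 0] y(2)[rule_format, of "x' - x"]
    have "H x = H y" "H x' = H (y + (x' - x))"
      by (simp_all add: dist_real_def)
    moreover have "dist (H (y + (x' - x))) (H y) < \<epsilon>"
      using y(1) d by (intro \<delta>(2)) (auto simp: dist_real_def)
    ultimately show ?thesis by simp
  qed
  then show "\<exists>d>0. \<forall>x\<in>UNIV. \<forall>x'\<in>UNIV. dist x' x < d \<longrightarrow> dist (H x') (H x) < \<epsilon>"
    using \<delta>(1) by (intro exI[of _ "min \<delta> 1"]) auto
qed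

text \<open>A Lebesgue number argument on the compact interval yields a constant for small distances;
  boundedness of \<open>H\<close> deals with the others.\<close>

lemma compactly_modelled_global_modulus:
  fixes H :: "real \<Rightarrow> 'b::metric_space"
  assumes H: "compactly_modelled H" "continuous_on UNIV H"
    and \<mu>: "concave_modulus \<mu>"
    and loc: "locally_modulus_continuous_on \<mu> UNIV H"
  obtains C where "C \<ge> 0" "\<And>x y. dist (H x) (H y) \<le> C * \<mu> (dist x y)"
proof -
  obtain R where R: "\<And>x. \<exists>y\<in>{-R..R}. \<forall>s. \<bar>s\<bar> < 1 \<longrightarrow> H (x + s) = H (y + s)"
    using H(1) unfolding compactly_modelled_def by blast
  obtain B where B: "B > 0" "\<And>x y. dist (H x) (H y) \<le> B"
    using compactly_modelled_bounded[OF H] by blast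
  have "\<exists>V c. open V \<and> x \<in> V \<and> c \<ge> 0 \<and> (\<forall>y\<in>V. \<forall>z\<in>V. dist (H y) (H z) \<le> c * \<mu> (dist y z))" for x
  proof -
    obtain V where "open V" "x \<in> V" "modulus_continuous_on \<mu> V H"
      using loc unfolding locally_modulus_continuous_on_def by auto
    then show ?thesis
      using modulus_continuous_onE[OF \<mu>, of V H] by metis
  qed
  then obtain V c where V: "\<And>x. open (V x)" "\<And>x. x \<in> V x" "\<And>x. c x \<ge> 0"
    "\<And>x y z. y \<in> V x \<Longrightarrow> z \<in> V x \<Longrightarrow> dist (H y) (H z) \<le> c x * \<mu> (dist y z)"
    by metis
  have cov: "{-R..R} \<subseteq> (\<Union>x\<in>{-R..R}. V x)"
    using V(2) by blast
  have cpt: "compact {-R..R}" by simp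
  obtain K where K: "K \<subseteq> {-R..R}" "finite K" "{-R..R} \<subseteq> (\<Union>x\<in>K. V x)"
    using compactE_image[OF cpt V(1) cov] by blast
  obtain \<delta> where \<delta>: "\<delta> > 0" "\<And>x. x \<in> {-R..R} \<Longrightarrow> \<exists>G\<in>V ` K. ball x \<delta> \<subseteq> G"
    using Heine_Borel_lemma[OF cpt K(3)] V(1) by blast
  have \<mu>nonneg: "0 \<le> \<mu> t" if "0 \<le> t" for t
    using concave_modulus_mono[OF \<mu>, of 0 t] concave_modulus_0[OF \<mu>] that by simp
  define r where "r = min \<delta> 1"
  have r: "r > 0" using \<delta> by (simp add: r_def)
  have "\<mu> r > 0" using concave_modulus_pos[OF \<mu> r] .
  define C where "C = sum c K + B / \<mu> r"
  have "sum c K \<ge> 0" using V(3) by (simp add: sum_nonneg)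
  have "dist (H x) (H x') \<le> C * \<mu> (dist x x')" for x x'
  proof (cases "dist x x' < r")
    case True
    obtain y where y: "y \<in> {-R..R}" "\<forall>s. \<bar>s\<bar> < 1 \<longrightarrow> H (x + s) = H (y + s)"
      using R by blast
    have "\<bar>x' - x\<bar> < 1" using True by (simp add: dist_real_def r_def abs_minus_commute)
    with y(2)[rule_format, of 0] y(2)[rule_format, of "x' - x"]
    have eq: "H x = H y" "H x' = H (y + (x' - x))"
      by (simp_all add: dist_real_def r_def)
    obtain u where u: "u \<in> K" "ball y \<delta> \<subseteq> V u"
      using \<delta>(2)[OF y(1)] by blast
    have "dist (H y) (H (y + (x' - x))) \<le> c u * \<mu> (dist y (y + (x' - x)))"
      using u(2) True \<delta>(1) by (intro V(4)) (auto simp: dist_real_def r_def)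
    also have "dist y (y + (x' - x)) = dist x x'"
      by (simp add: dist_real_def)
    also have "c u * \<mu> (dist x x') \<le> C * \<mu> (dist x x')"
    proof (rule mult_right_mono)
      have "c u \<le> sum c K"
        using u(1) K(2) V(3) by (intro member_le_sum) auto
      then show "c u \<le> C"
        unfolding C_def using B(1) \<open>\<mu> r > 0\<close> by (simp add: add_increasing2)
    qed (simp add: \<mu>nonneg)
    finally show ?thesis by (simp add: eq)
  next
    case False
    have "dist (H x) (H x') \<le> B / \<mu> r * \<mu> r"
      using B(2) \<open>\<mu> r > 0\<close> by simp
    also have "\<dots> \<le> B / \<mu> r * \<mu> (dist x x')"
      using False r B(1) \<open>\<mu> r > 0\<close> by (intro mult_left_mono concave_modulus_mono[OF \<mu>]) auto
    also have "\<dots> \<le> C * \<mu> (dist x x')"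
      unfolding C_def using \<open>sum c K \<ge> 0\<close> by (intro mult_right_mono) (auto simp: \<mu>nonneg)
    finally show ?thesis .
  qed
  moreover have "C \<ge> 0"
    unfolding C_def using \<open>sum c K \<ge> 0\<close> B(1) \<open>\<mu> r > 0\<close> by simp
  ultimately show ?thesis using that by blast
qed


section \<open>The optimal concave modulus of a function\<close>

text \<open>The pairs \<open>(a, b)\<close> for which the affine function \<open>t \<mapsto> a + b * t\<close> bounds the modulus of
  continuity of \<open>H\<close>.\<close>

definition affine_majorants :: "(real \<Rightarrow> 'b::metric_space) \<Rightarrow> (real \<times> real) set" where
  "affine_majorants H =
     {(a, b). 0 \<le> a \<and> 0 \<le> b \<and> (\<forall>x y. dist (H x) (H y) \<le> a + b * dist x y)}"

text \<open>For bounded and uniformly continuous \<open>H\<close> this infimum of affine functions is the least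
  concave majorant of the modulus of continuity of \<open>H\<close>.\<close>

definition concave_envelope :: "(real \<Rightarrow> 'b::metric_space) \<Rightarrow> real \<Rightarrow> real" where
  "concave_envelope H t = (INF (a, b)\<in>affine_majorants H. a + b * t)"

lemma concave_envelope_le:
  assumes "(a, b) \<in> affine_majorants H" "0 \<le> t"
  shows "concave_envelope H t \<le> a + b * t"
  unfolding concave_envelope_def
proof (rule cINF_lower2[OF _ assms(1)])
  show "bdd_below ((\<lambda>(a, b). a + b * t) ` affine_majorants H)"
    using assms(2) by (intro bdd_belowI[of _ 0]) (auto simp: affine_majorants_def)
qed simp

lemma concave_envelope_ge:
  assumes "affine_majorants H \<noteq> {}" "\<And>a b. (a, b) \<in> affine_majorants H \<Longrightarrow> m \<le> a + b * t"
  shows "m \<le> concave_envelope H t"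
  unfolding concave_envelope_def using assms by (intro cINF_greatest) auto

lemma affine_majorants_uniformly_continuous:
  fixes H :: "real \<Rightarrow> 'b::metric_space"
  assumes "uniformly_continuous_on UNIV H" "B > 0" "\<And>x y. dist (H x) (H y) \<le> B" "\<epsilon> > 0"
  obtains b where "(\<epsilon>, b) \<in> affine_majorants H"
proof -
  obtain \<delta> where \<delta>: "\<delta> > 0" "\<And>x x'. dist x' x < \<delta> \<Longrightarrow> dist (H x') (H x) < \<epsilon>"
    using assms(1,4) unfolding uniformly_continuous_on_def by (meson UNIV_I)
  have "dist (H x) (H y) \<le> \<epsilon> + (B / \<delta>) * dist x y" for x y
  proof (cases "dist x y < \<delta>")
    case True
    then have "dist (H x) (H y) < \<epsilon>" using \<delta>(2) by blast
    moreover have "0 \<le> (B / \<delta>) * dist x y" using \<delta>(1) assms(2) by simp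
    ultimately show ?thesis by linarith
  next
    case False
    have "dist (H x) (H y) \<le> (B / \<delta>) * \<delta>"
      using assms(3) \<delta>(1) by simp
    also have "\<dots> \<le> (B / \<delta>) * dist x y"
      using False \<delta>(1) assms(2) by (intro mult_left_mono) auto
    finally show ?thesis using assms(4) by linarith
  qed
  then show ?thesis
    using that[of "B / \<delta>"] assms \<delta>(1) by (simp add: affine_majorants_def)
qed

lemma concave_envelope_modulus:
  fixes H :: "real \<Rightarrow> 'b::metric_space"
  assumes uc: "uniformly_continuous_on UNIV H" and B: "B > 0" "\<And>x y. dist (H x) (H y) \<le> B"
  shows "concave_modulus (\<lambda>t. concave_envelope H t + t)"
    and "dist (H x) (H y) \<le> concave_envelope H (dist x y)"
proof -
  let ?w = "concave_envelope H"
  note small = affine_majorants_uniformly_continuous[OF uc B]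
  have ne: "affine_majorants H \<noteq> {}"
    using small[of 1] by (metis emptyE zero_less_one)
  show "dist (H x) (H y) \<le> ?w (dist x y)"
    using ne by (rule concave_envelope_ge) (auto simp: affine_majorants_def)
  have nonneg: "0 \<le> ?w t" if "0 \<le> t" for t
    using ne that by (intro concave_envelope_ge) (auto simp: affine_majorants_def)
  have mono: "?w s \<le> ?w t" if "0 \<le> s" "s \<le> t" for s t
  proof (rule concave_envelope_ge[OF ne])
    fix a b assume ab: "(a, b) \<in> affine_majorants H"
    have "?w s \<le> a + b * s" using concave_envelope_le[OF ab that(1)] .
    also have "\<dots> \<le> a + b * t"
      using ab that by (simp add: affine_majorants_def mult_left_mono)
    finally show "?w s \<le> a + b * t" .
  qed
  have conc: "concave_on {0..} ?w"
    unfolding concave_on_iff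
  proof (intro conjI ballI allI impI)
    fix x y u v :: real
    assume xy: "x \<in> {0..}" "y \<in> {0..}" and uv: "0 \<le> u" "0 \<le> v" "u + v = 1"
    show "u * ?w x + v * ?w y \<le> ?w (u *\<^sub>R x + v *\<^sub>R y)"
    proof (rule concave_envelope_ge[OF ne])
      fix a b assume ab: "(a, b) \<in> affine_majorants H"
      have "u * ?w x + v * ?w y \<le> u * (a + b * x) + v * (a + b * y)"
        using xy uv concave_envelope_le[OF ab] by (intro add_mono mult_left_mono) auto
      also have "\<dots> = (u + v) * a + b * (u *\<^sub>R x + v *\<^sub>R y)"
        by (simp add: algebra_simps)
      finally show "u * ?w x + v * ?w y \<le> a + b * (u *\<^sub>R x + v *\<^sub>R y)"
        using uv(3) by simp
    qed
  qed auto
  have small0: "\<exists>\<delta>>0. \<forall>t\<ge>0. t < \<delta> \<longrightarrow> ?w t < \<epsilon>" if "\<epsilon> > 0" for \<epsilon>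
  proof -
    obtain b where b: "(\<epsilon> / 2, b) \<in> affine_majorants H"
      using small[of "\<epsilon> / 2"] \<open>\<epsilon> > 0\<close> by auto
    then have "b \<ge> 0" by (simp add: affine_majorants_def)
    have "?w t < \<epsilon>" if "0 \<le> t" "t < \<epsilon> / (2 * (b + 1))" for t
    proof -
      have "?w t \<le> \<epsilon> / 2 + b * t" using concave_envelope_le[OF b that(1)] .
      also have "b * t \<le> (b + 1) * t" using that by (simp add: mult_right_mono)
      also have "(b + 1) * t < \<epsilon> / 2" using that \<open>b \<ge> 0\<close> by (simp add: field_simps)
      finally show ?thesis by simp
    qed
    then show ?thesis
      using \<open>b \<ge> 0\<close> \<open>\<epsilon> > 0\<close> by (intro exI[of _ "\<epsilon> / (2 * (b + 1))"]) auto
  qed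
  have w0: "?w 0 = 0"
  proof (rule antisym)
    show "?w 0 \<le> 0"
    proof (rule field_le_epsilon)
      fix \<epsilon> :: real assume "\<epsilon> > 0"
      then have "?w 0 < \<epsilon>" using small0 by blast
      then show "?w 0 \<le> 0 + \<epsilon>" by simp
    qed
  qed (simp add: nonneg)
  have cont: "continuous_on {0..} ?w"
    unfolding continuous_on_eq_continuous_within
  proof
    fix t :: real assume "t \<in> {0..}"
    then consider "t = 0" | "t > 0" by fastforce
    then show "continuous (at t within {0..}) ?w"
    proof cases
      case 1
      show ?thesis
        unfolding 1 continuous_within_eps_delta
      proof (intro allI impI)
        fix \<epsilon> :: real assume "\<epsilon> > 0"
        then obtain \<delta> where "\<delta> > 0" "\<forall>t\<ge>0. t < \<delta> \<longrightarrow> ?w t < \<epsilon>" using small0 by blast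
        then show "\<exists>d>0. \<forall>x'\<in>{0..}. dist x' 0 < d \<longrightarrow> dist (?w x') (?w 0) < \<epsilon>"
          using nonneg by (intro exI[of _ \<delta>]) (auto simp: w0 dist_real_def)
      qed
    next
      case 2
      have "convex_on {0<..} (\<lambda>t. - ?w t)"
        using conc unfolding concave_on_def by (rule convex_on_subset) auto
      then have "continuous_on {0<..} (\<lambda>t. - (- ?w t))"
        by (intro continuous_on_minus convex_on_continuous) auto
      then have "isCont ?w t"
        using 2 by (simp add: continuous_on_eq_continuous_at)
      then show ?thesis by (rule continuous_at_imp_continuous_within)
    qed
  qed
  show "concave_modulus (\<lambda>t. ?w t + t)"
  proof (rule concave_modulusI)
    show "concave_on {0..} (\<lambda>t. ?w t + t)"
      using conc by (intro concave_on_add) (auto simp: concave_on_ident)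
    show "continuous_on {0..} (\<lambda>t. ?w t + t)"
      using cont by (intro continuous_intros)
    show "strict_mono_on {0..} (\<lambda>t. ?w t + t)"
      using mono by (intro strict_mono_onI) (simp add: add_le_less_mono)
    show "?w 0 + 0 = 0" by (simp add: w0)
    show "\<exists>t\<ge>0. C \<le> ?w t + t" for C
      using nonneg[of "max C 0"] by (intro exI[of _ "max C 0"]) auto
  qed
qed

text \<open>The affine function \<open>s \<mapsto> \<mu> t + (\<mu> t / t) * s\<close> lies above the concave modulus \<open>\<mu>\<close>, and at
  \<open>s = t\<close> it takes the value \<open>2 * \<mu> t\<close>. It replaces a supporting line, at the price of a factor 2.\<close>

lemma concave_envelope_least:
  fixes H :: "real \<Rightarrow> 'b::metric_space"
  assumes \<mu>: "concave_modulus \<mu>" and "C \<ge> 0" and H: "\<And>x y. dist (H x) (H y) \<le> C * \<mu> (dist x y)"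
    and "0 < t"
  shows "concave_envelope H t \<le> 2 * C * \<mu> t"
proof -
  have pos: "0 < \<mu> t" using concave_modulus_pos[OF \<mu> \<open>0 < t\<close>] .
  have "\<mu> s \<le> \<mu> t + \<mu> t / t * s" if "0 \<le> s" for s
  proof (cases "s \<le> t")
    case True
    then have "\<mu> s \<le> \<mu> t" using concave_modulus_mono[OF \<mu>] that by blast
    moreover have "0 \<le> \<mu> t / t * s" using pos that \<open>0 < t\<close> by simp
    ultimately show ?thesis by linarith
  next
    case False
    then have "t / s * \<mu> s \<le> \<mu> (t / s * s)"
      using \<open>0 < t\<close> by (intro concave_modulus_scale[OF \<mu>]) auto
    then have "\<mu> s \<le> \<mu> t / t * s"
      using False \<open>0 < t\<close> by (simp add: field_simps)
    then show ?thesis using pos by linarith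
  qed
  then have "C * \<mu> (dist x y) \<le> C * (\<mu> t + \<mu> t / t * dist x y)" for x y :: real
    using \<open>C \<ge> 0\<close> by (intro mult_left_mono) auto
  then have "C * \<mu> (dist x y) \<le> C * \<mu> t + (C * \<mu> t / t) * dist x y" for x y :: real
    by (simp add: distrib_left mult.assoc)
  then have "dist (H x) (H y) \<le> C * \<mu> t + (C * \<mu> t / t) * dist x y" for x y
    using H[of x y] order_trans by blast
  then have "(C * \<mu> t, C * \<mu> t / t) \<in> affine_majorants H"
    using pos \<open>C \<ge> 0\<close> \<open>0 < t\<close> by (simp add: affine_majorants_def)
  then have "concave_envelope H t \<le> C * \<mu> t + C * \<mu> t / t * t"
    using \<open>0 < t\<close> by (intro concave_envelope_le) auto
  then show ?thesis using \<open>0 < t\<close> by simp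
qed

text \<open>The modulus \<open>\<nu>\<close> is optimal for \<open>H\<close>: near zero it is dominated, up to constants, by every
  concave modulus with respect to which \<open>H\<close> is locally continuous.\<close>

lemma exists_optimal_modulus:
  fixes H :: "real \<Rightarrow> 'b::metric_space"
  assumes H: "compactly_modelled H" "continuous_on UNIV H"
  obtains \<nu> where "concave_modulus \<nu>" "locally_modulus_continuous_on \<nu> UNIV H"
    "\<And>\<mu>. concave_modulus \<mu> \<Longrightarrow> locally_modulus_continuous_on \<mu> UNIV H \<Longrightarrow>
       \<exists>C. \<forall>t. 0 \<le> t \<longrightarrow> t \<le> 1 \<longrightarrow> \<nu> t \<le> C * \<mu> t"
proof -
  obtain B where B: "B > 0" "\<And>x y. dist (H x) (H y) \<le> B"
    using compactly_modelled_bounded[OF H] by blast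
  note uc = compactly_modelled_uniformly_continuous[OF H]
  \<comment> \<open>The summand \<open>t\<close> makes the modulus strictly increasing and unbounded; near zero it is dominated
    by every concave modulus.\<close>
  define \<nu> where "\<nu> = (\<lambda>t. concave_envelope H t + t)"
  have \<nu>: "concave_modulus \<nu>"
    unfolding \<nu>_def by (rule concave_envelope_modulus[OF uc B])
  have le: "dist (H x) (H y) \<le> 1 * \<nu> (dist x y)" for x y
    using concave_envelope_modulus(2)[OF uc B, of x y] by (simp add: \<nu>_def add_increasing2)
  have "modulus_continuous_on \<nu> UNIV H"
    using le by (intro modulus_continuous_onI[OF \<nu>])
  then have loc: "locally_modulus_continuous_on \<nu> UNIV H"
    unfolding locally_modulus_continuous_on_def by (auto intro!: exI[of _ UNIV])
  have "\<exists>C. \<forall>t. 0 \<le> t \<longrightarrow> t \<le> 1 \<longrightarrow> \<nu> t \<le> C * \<mu> t"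
    if \<mu>: "concave_modulus \<mu>" and l: "locally_modulus_continuous_on \<mu> UNIV H" for \<mu>
  proof -
    obtain C where C: "C \<ge> 0" "\<And>x y. dist (H x) (H y) \<le> C * \<mu> (dist x y)"
      using compactly_modelled_global_modulus[OF H \<mu> l] by blast
    have m1: "\<mu> 1 > 0" using concave_modulus_pos[OF \<mu>] by simp
    have "\<nu> t \<le> (2 * C + 1 / \<mu> 1) * \<mu> t" if t: "0 \<le> t" "t \<le> 1" for t
    proof (cases "t = 0")
      case True
      then show ?thesis
        by (simp add: concave_modulus_0[OF \<nu>] concave_modulus_0[OF \<mu>])
    next
      case False
      have "t * \<mu> 1 \<le> \<mu> t"
        using concave_modulus_scale[OF \<mu> t, of 1] by simp
      then have "t \<le> 1 / \<mu> 1 * \<mu> t" using m1 by (simp add: field_simps)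
      moreover have "concave_envelope H t \<le> 2 * C * \<mu> t"
        using concave_envelope_least[OF \<mu> C] t False by simp
      ultimately show ?thesis by (simp add: \<nu>_def distrib_right)
    qed
    then show ?thesis by blast
  qed
  with \<nu> loc show ?thesis using that by blast
qed

text \<open>Since \<open>\<nu> t \<le> sqrt (\<nu> 1) * sqrt (\<nu> t)\<close> for \<open>t \<le> 1\<close>, an optimal modulus may be replaced by its
  square root.\<close>

lemma exists_sup_tame_modulus:
  fixes H :: "real \<Rightarrow> 'b::metric_space"
  assumes H: "compactly_modelled H" "continuous_on UNIV H"
  obtains \<gamma> where "concave_modulus \<gamma>" "sup_tame \<gamma>" "locally_modulus_continuous_on \<gamma> UNIV H"
proof -
  obtain \<nu> where \<nu>: "concave_modulus \<nu>" and loc: "locally_modulus_continuous_on \<nu> UNIV H"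
    using exists_optimal_modulus[OF H] by metis
  note \<gamma> = concave_modulus_sqrt[OF \<nu>]
  have "\<nu> t \<le> sqrt (\<nu> 1) * sqrt (\<nu> t)" if "0 \<le> t" "t \<le> 1" for t
  proof -
    have "\<nu> t \<le> \<nu> 1" "0 \<le> \<nu> t"
      using concave_modulus_mono[OF \<nu>, of t 1] concave_modulus_mono[OF \<nu>, of 0 t]
        concave_modulus_0[OF \<nu>] that by auto
    then have "sqrt (\<nu> t) * sqrt (\<nu> t) \<le> sqrt (\<nu> 1) * sqrt (\<nu> t)"
      by (intro mult_right_mono) auto
    with \<open>0 \<le> \<nu> t\<close> show ?thesis by simp
  qed
  then have "locally_modulus_continuous_on (\<lambda>t. sqrt (\<nu> t)) UNIV H"
    by (rule locally_modulus_continuous_on_dominated[OF \<nu> \<gamma> _ loc])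
  with \<gamma> sup_tame_sqrt[OF \<nu>] show ?thesis using that by blast
qed

text \<open>The reduction to functions on the line: it suffices that membership of \<open>f\<close> in the class of a
  modulus is governed by the local continuity of a compactly modelled function \<open>H f\<close>. A family of
  moduli realising an intersection consists of all moduli whose class is contained in it.\<close>

lemma regularity_classes:
  fixes D :: "'d set" and Dm :: "(real \<Rightarrow> real) \<Rightarrow> 'd set" and H :: "'d \<Rightarrow> real \<Rightarrow> 'b::metric_space"
  assumes model: "\<And>f. f \<in> D \<Longrightarrow> compactly_modelled (H f) \<and> continuous_on UNIV (H f)"
    and Dm: "\<And>f \<alpha>. concave_modulus \<alpha> \<Longrightarrow>
      f \<in> Dm \<alpha> \<longleftrightarrow> f \<in> D \<and> locally_modulus_continuous_on \<alpha> UNIV (H f)"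
  shows "D = (\<Union>\<beta>\<in>{\<beta>. concave_modulus \<beta>}. Dm \<beta>) \<and>
      D = (\<Union>\<gamma>\<in>{\<gamma>. concave_modulus \<gamma> \<and> sup_tame \<gamma>}. Dm \<gamma>) \<and>
      (\<forall>F0. (\<forall>\<mu>\<in>F0. concave_modulus \<mu>) \<longrightarrow>
        (\<exists>F. (\<forall>\<nu>\<in>F. concave_modulus \<nu>) \<and> D \<inter> (\<Inter>\<mu>\<in>F0. Dm \<mu>) = (\<Union>\<nu>\<in>F. Dm \<nu>)))"
proof (intro conjI allI impI)
  have tame: "\<exists>\<gamma>. concave_modulus \<gamma> \<and> sup_tame \<gamma> \<and> f \<in> Dm \<gamma>" if "f \<in> D" for f
    using model[OF that] exists_sup_tame_modulus[of "H f"] Dm that by metis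
  show "D = (\<Union>\<beta>\<in>{\<beta>. concave_modulus \<beta>}. Dm \<beta>)"
    using tame Dm by blast
  show "D = (\<Union>\<gamma>\<in>{\<gamma>. concave_modulus \<gamma> \<and> sup_tame \<gamma>}. Dm \<gamma>)"
    using tame Dm by blast
next
  fix F0 :: "(real \<Rightarrow> real) set" assume F0: "\<forall>\<mu>\<in>F0. concave_modulus \<mu>"
  let ?I = "D \<inter> (\<Inter>\<mu>\<in>F0. Dm \<mu>)"
  define F where "F = {\<nu>. concave_modulus \<nu> \<and> Dm \<nu> \<subseteq> ?I}"
  have "\<exists>\<nu>\<in>F. f \<in> Dm \<nu>" if f: "f \<in> ?I" for f
  proof -
    obtain \<nu> where \<nu>: "concave_modulus \<nu>" "locally_modulus_continuous_on \<nu> UNIV (H f)"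
      "\<And>\<mu>. concave_modulus \<mu> \<Longrightarrow> locally_modulus_continuous_on \<mu> UNIV (H f) \<Longrightarrow>
         \<exists>C. \<forall>t. 0 \<le> t \<longrightarrow> t \<le> 1 \<longrightarrow> \<nu> t \<le> C * \<mu> t"
      using exists_optimal_modulus[of "H f"] model[of f] f by blast
    have "Dm \<nu> \<subseteq> Dm \<mu>" if "\<mu> \<in> F0" for \<mu>
    proof
      fix g assume g: "g \<in> Dm \<nu>"
      have \<mu>: "concave_modulus \<mu>" using F0 that by blast
      then have "locally_modulus_continuous_on \<mu> UNIV (H f)"
        using f that Dm by blast
      then obtain C where "\<And>t. 0 \<le> t \<Longrightarrow> t \<le> 1 \<Longrightarrow> \<nu> t \<le> C * \<mu> t"
        using \<nu>(3)[OF \<mu>] by blast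
      then show "g \<in> Dm \<mu>"
        using g Dm[OF \<nu>(1)] Dm[OF \<mu>] locally_modulus_continuous_on_dominated[OF \<nu>(1) \<mu>] by blast
    qed
    moreover have "Dm \<nu> \<subseteq> D" using Dm[OF \<nu>(1)] by blast
    ultimately have "\<nu> \<in> F" using \<nu>(1) unfolding F_def by blast
    moreover have "f \<in> Dm \<nu>" using Dm[OF \<nu>(1)] \<nu>(2) f by blast
    ultimately show ?thesis by blast
  qed
  then have "?I = (\<Union>\<nu>\<in>F. Dm \<nu>)"
    unfolding F_def by blast
  moreover have "\<forall>\<nu>\<in>F. concave_modulus \<nu>" by (simp add: F_def)
  ultimately show "\<exists>F. (\<forall>\<nu>\<in>F. concave_modulus \<nu>) \<and> ?I = (\<Union>\<nu>\<in>F. Dm \<nu>)"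
    by blast
qed


section \<open>The real line\<close>

lemma deriv_add_const: "deriv (\<lambda>s. g s + c) = deriv (g :: real \<Rightarrow> real)"
  by (simp add: fun_eq_iff deriv_def DERIV_def)

lemma higher_deriv_translate:
  fixes g g' :: "real \<Rightarrow> real"
  assumes "k > 0" "\<forall>\<^sub>F s in nhds 0. g' (t' + s) = g (t + s) + c"
  shows "(deriv ^^ k) g' t' = (deriv ^^ k) g t"
proof -
  obtain n where k: "k = Suc n" using assms(1) gr0_implies_Suc by blast
  have "(deriv ^^ k) g' t' = (deriv ^^ k) (\<lambda>s. g' (t' + s)) 0"
    by (subst higher_deriv_shift_0) (simp add: o_def)
  also have "\<dots> = (deriv ^^ k) (\<lambda>s. g (t + s) + c) 0"
    using assms(2) by (rule higher_deriv_cong_ev) simp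
  also have "\<dots> = (deriv ^^ k) (\<lambda>s. g (t + s)) 0"
    unfolding k funpow_Suc_right by (simp add: deriv_add_const)
  also have "\<dots> = (deriv ^^ k) g t"
    by (subst (2) higher_deriv_shift_0) (simp add: o_def)
  finally show ?thesis .
qed

lemma compactly_modelled_const_outside:
  assumes "\<And>x. \<bar>x\<bar> > R \<Longrightarrow> H x = c"
  shows "compactly_modelled H"
  unfolding compactly_modelled_def
proof (intro exI[of _ "\<bar>R\<bar> + 1"] allI)
  fix x
  show "\<exists>y\<in>{-(\<bar>R\<bar> + 1)..\<bar>R\<bar> + 1}. \<forall>s. \<bar>s\<bar> < 1 \<longrightarrow> H (x + s) = H (y + s)"
  proof (cases "\<bar>x\<bar> \<le> \<bar>R\<bar> + 1")
    case True
    then show ?thesis by (intro bexI[of _ x]) auto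
  next
    case False
    have "H (x + s) = H (\<bar>R\<bar> + 1 + s)" if "\<bar>s\<bar> < 1" for s
    proof -
      have "\<bar>x + s\<bar> > R" "\<bar>\<bar>R\<bar> + 1 + s\<bar> > R" using False that by linarith+
      then show ?thesis by (simp only: assms)
    qed
    then show ?thesis by (intro bexI[of _ "\<bar>R\<bar> + 1"]) auto
  qed
qed

lemma Ck_mod_map_real_iff:
  "Ck_mod_map UNIV real_atlas k \<alpha> f \<longleftrightarrow>
     Ck_map UNIV real_atlas k f \<and> locally_modulus_continuous_on \<alpha> UNIV ((deriv ^^ k) f)"
proof -
  have "local_rep (UNIV, id) (UNIV, id) f = f" "local_dom (UNIV, id) (UNIV, id) f = UNIV"
    by (simp_all add: local_rep_def local_dom_def fun_eq_iff)
  then show ?thesis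
    by (auto simp: Ck_mod_map_def Ck_map_def Ck_mod_on_def real_atlas_def)
qed

text \<open>Outside a compact interval \<open>f\<close> and its inverse are the identity, so that their \<open>k\<close>-th
  derivatives are constant there.\<close>

lemma D_real_classes:
  assumes "k > 0"
  defines "H \<equiv> \<lambda>f x. ((deriv ^^ k) f x, (deriv ^^ k) (inv f) x)"
  shows "f \<in> D_real k \<Longrightarrow> compactly_modelled (H f) \<and> continuous_on UNIV (H f)"
    and "concave_modulus \<alpha> \<Longrightarrow>
      f \<in> D_real_mod k \<alpha> \<longleftrightarrow> f \<in> D_real k \<and> locally_modulus_continuous_on \<alpha> UNIV (H f)"
proof -
  assume f: "f \<in> D_real k"
  then have "inj f"
    by (simp add: D_real_def diffeos_def bij_betw_def)
  from f have "bounded (closure {x. f x \<noteq> x})"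
    by (simp add: D_real_def compactly_supported_def compact_imp_bounded)
  then obtain R where "\<forall>x\<in>closure {x. f x \<noteq> x}. norm x \<le> R"
    unfolding bounded_iff by blast
  then have fix_f: "f x = x" if "\<bar>x\<bar> > R" for x
    using that closure_subset[of "{x. f x \<noteq> x}"] by force
  have fix_inv: "inv f x = x" if "\<bar>x\<bar> > R" for x
    using inv_f_f[OF \<open>inj f\<close>, of x] fix_f[OF that] by simp
  have outside: "(deriv ^^ k) g x = (deriv ^^ k) (\<lambda>x. x) 0"
    if "\<bar>x\<bar> > R" and g: "\<And>x. \<bar>x\<bar> > R \<Longrightarrow> g x = x" for g :: "real \<Rightarrow> real" and x
  proof (rule higher_deriv_translate[OF assms(1)])
    have "\<forall>\<^sub>F s in nhds 0. dist s 0 < \<bar>x\<bar> - R"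
      using that(1) by (auto simp: eventually_nhds_metric intro!: exI[of _ "\<bar>x\<bar> - R"])
    then show "\<forall>\<^sub>F s in nhds 0. g (x + s) = 0 + s + x"
    proof eventually_elim
      case (elim s)
      then have "\<bar>x + s\<bar> > R" unfolding dist_real_def by linarith
      then show ?case using g by simp
    qed
  qed
  have "H f x = ((deriv ^^ k) (\<lambda>x. x) 0, (deriv ^^ k) (\<lambda>x. x) 0)" if "\<bar>x\<bar> > R" for x
    unfolding H_def using outside[OF that, of f] outside[OF that, of "inv f"] fix_f fix_inv by simp
  then have "compactly_modelled (H f)"
    by (rule compactly_modelled_const_outside)
  moreover have "continuous_on UNIV (H f)"
    using f unfolding H_def D_real_def diffeos_def
    by (intro continuous_on_Pair) (auto simp: Ck_map_real_iff Ck_on_def)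
  ultimately show "compactly_modelled (H f) \<and> continuous_on UNIV (H f)" ..
next
  assume "concave_modulus \<alpha>"
  then show "f \<in> D_real_mod k \<alpha> \<longleftrightarrow> f \<in> D_real k \<and> locally_modulus_continuous_on \<alpha> UNIV (H f)"
    unfolding H_def
    by (auto simp: locally_modulus_continuous_on_Pair D_real_mod_def D_real_def diffeos_mod_def
        diffeos_def Ck_mod_map_real_iff)
qed


section \<open>The circle\<close>

text \<open>The inverse chart of the circle by angles around \<open>\<theta>\<close>.\<close>

abbreviation angle_chart :: "real \<Rightarrow> real set \<times> (real \<Rightarrow> complex)" where
  "angle_chart \<theta> \<equiv> ({\<theta> - pi <..< \<theta> + pi}, cis)"

lemma Arg_cis_shift:
  assumes "u \<in> {\<phi> - pi <..< \<phi> + pi}"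
  shows "Arg (cis u * cis (- \<phi>)) = u - \<phi>"
  using assms by (simp add: cis_mult Arg_cis)

lemma inv_into_cis:
  assumes "z \<in> cis ` {\<phi> - pi <..< \<phi> + pi}"
  shows "inv_into {\<phi> - pi <..< \<phi> + pi} cis z = \<phi> + Arg (z * cis (- \<phi>))"
proof -
  have "inj_on cis {\<phi> - pi <..< \<phi> + pi}"
    by (rule inj_onI) (metis Arg_cis_shift diff_add_cancel)
  with assms show ?thesis
    by (auto simp: inv_into_f_f Arg_cis_shift simp del: cis_mult)
qed

lemma angle_chart_image_iff:
  assumes "z \<in> circle"
  shows "z \<in> cis ` {\<phi> - pi <..< \<phi> + pi} \<longleftrightarrow> z * cis (- \<phi>) \<notin> \<real>\<^sub>\<le>\<^sub>0"
proof
  assume "z \<in> cis ` {\<phi> - pi <..< \<phi> + pi}"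
  then obtain u where u: "u \<in> {\<phi> - pi <..< \<phi> + pi}" "z = cis u" by blast
  show "z * cis (- \<phi>) \<notin> \<real>\<^sub>\<le>\<^sub>0"
  proof
    assume "z * cis (- \<phi>) \<in> \<real>\<^sub>\<le>\<^sub>0"
    moreover have "z * cis (- \<phi>) \<noteq> 0" by (simp add: u(2))
    ultimately have "Arg (z * cis (- \<phi>)) = pi"
      by (auto simp: Arg_eq_pi complex_nonpos_Reals_iff complex_eq_iff)
    with u show False by (simp only: Arg_cis_shift) simp
  qed
next
  assume notin: "z * cis (- \<phi>) \<notin> \<real>\<^sub>\<le>\<^sub>0"
  let ?v = "Arg (z * cis (- \<phi>))"
  have n: "norm (z * cis (- \<phi>)) = 1" using assms by (simp add: norm_mult)
  then have "z * cis (- \<phi>) \<noteq> 0" by auto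
  then have "cis ?v = z * cis (- \<phi>)"
    using n by (simp add: cis_Arg sgn_div_norm)
  then have "cis (\<phi> + ?v) = z * (cis \<phi> * cis (- \<phi>))"
    by (simp add: mult_ac flip: cis_mult)
  then have "z = cis (\<phi> + ?v)" by (simp add: cis_mult)
  moreover have "?v \<noteq> pi"
    using notin by (auto simp: Arg_eq_pi complex_nonpos_Reals_iff)
  then have "\<phi> + ?v \<in> {\<phi> - pi <..< \<phi> + pi}"
    using mpi_less_Arg[of "z * cis (- \<phi>)"] Arg_le_pi[of "z * cis (- \<phi>)"] by auto
  ultimately show "z \<in> cis ` {\<phi> - pi <..< \<phi> + pi}" by blast
qed

lemma continuous_on_circle_cis:
  assumes "continuous_on circle f"
  shows "continuous_on S (\<lambda>t. f (cis t))"
  using assms by (rule continuous_on_compose2) (auto intro!: continuous_intros)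

lemma angle_chart_local_dom:
  assumes "f \<in> circle \<rightarrow> circle"
  shows "local_dom (angle_chart \<theta>) (angle_chart \<phi>) f =
    {\<theta> - pi <..< \<theta> + pi} \<inter> (\<lambda>t. f (cis t) * cis (- \<phi>)) -` (- \<real>\<^sub>\<le>\<^sub>0)"
proof -
  have "f (cis t) \<in> circle" for t
    using assms by (auto simp: Pi_iff)
  then show ?thesis
    using angle_chart_image_iff by (auto simp: local_dom_def)
qed

lemma open_angle_chart_local_dom:
  assumes "f \<in> circle \<rightarrow> circle" "continuous_on circle f"
  shows "open (local_dom (angle_chart \<theta>) (angle_chart \<phi>) f)"
  unfolding angle_chart_local_dom[OF assms(1)]
  using closed_nonpos_Reals_complex
  by (intro open_Int open_vimage) (auto intro!: continuous_intros continuous_on_circle_cis assms(2))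

lemma angle_chart_local_rep:
  assumes "t \<in> local_dom (angle_chart \<theta>) (angle_chart \<phi>) f"
  shows "local_rep (angle_chart \<theta>) (angle_chart \<phi>) f t = \<phi> + Arg (f (cis t) * cis (- \<phi>))"
    and "cis (local_rep (angle_chart \<theta>) (angle_chart \<phi>) f t) = f (cis t)"
proof -
  have "f (cis t) \<in> cis ` {\<phi> - pi <..< \<phi> + pi}"
    using assms by (simp add: local_dom_def)
  then show "local_rep (angle_chart \<theta>) (angle_chart \<phi>) f t = \<phi> + Arg (f (cis t) * cis (- \<phi>))"
    and "cis (local_rep (angle_chart \<theta>) (angle_chart \<phi>) f t) = f (cis t)"
    using inv_into_cis[of "f (cis t)" \<phi>] f_inv_into_f[of "f (cis t)" cis "{\<phi> - pi <..< \<phi> + pi}"]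
    by (simp_all only: local_rep_def o_apply fst_conv snd_conv)
qed

lemma continuous_on_angle_chart_local_rep:
  assumes "f \<in> circle \<rightarrow> circle" "continuous_on circle f"
  shows "continuous_on (local_dom (angle_chart \<theta>) (angle_chart \<phi>) f)
    (local_rep (angle_chart \<theta>) (angle_chart \<phi>) f)"
proof -
  let ?U = "local_dom (angle_chart \<theta>) (angle_chart \<phi>) f"
  have "continuous_on (- \<real>\<^sub>\<le>\<^sub>0) Arg"
    by (intro continuous_at_imp_continuous_on) (simp add: continuous_at_Arg)
  then have "continuous_on ?U (\<lambda>t. Arg (f (cis t) * cis (- \<phi>)))"
    by (rule continuous_on_compose2)
      (auto simp: angle_chart_local_dom[OF assms(1)]
        intro!: continuous_intros continuous_on_circle_cis assms(2))
  then have "continuous_on ?U (\<lambda>t. \<phi> + Arg (f (cis t) * cis (- \<phi>)))"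
    by (intro continuous_on_add continuous_on_const)
  then show ?thesis
    by (rule continuous_on_eq) (simp add: angle_chart_local_rep(1))
qed

lemma cis_eq_1_small:
  assumes "cis x = 1" "\<bar>x\<bar> < 2 * pi"
  shows "x = 0"
proof -
  have "cos x = 1" using assms(1) by (metis cis.sel(1) one_complex.sel(1))
  then obtain n :: int where n: "x = of_int n * 2 * pi"
    using cos_one_2pi_int by blast
  with assms(2) have "\<bar>of_int n * (2 * pi)\<bar> < 1 * (2 * pi)" by (simp add: mult.assoc)
  then have "\<bar>of_int n :: real\<bar> < 1"
    by (simp add: abs_mult)
  then have "n = 0" by linarith
  with n show ?thesis by simp
qed

text \<open>Two coordinate expressions around the same point of the circle differ, after a translation of
  the argument, by a continuous function with values in the multiples of \<open>2 * pi\<close>.\<close>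

lemma higher_deriv_angle_chart_independent:
  assumes k: "k > 0" and f: "f \<in> circle \<rightarrow> circle" "continuous_on circle f"
    and t: "t \<in> local_dom (angle_chart \<theta>) (angle_chart \<phi>) f"
    and t': "t' \<in> local_dom (angle_chart \<theta>') (angle_chart \<phi>') f"
    and eq: "cis t = cis t'"
  shows "(deriv ^^ k) (local_rep (angle_chart \<theta>') (angle_chart \<phi>') f) t' =
    (deriv ^^ k) (local_rep (angle_chart \<theta>) (angle_chart \<phi>) f) t"
proof -
  let ?U = "local_dom (angle_chart \<theta>) (angle_chart \<phi>) f"
  let ?U' = "local_dom (angle_chart \<theta>') (angle_chart \<phi>') f"
  define g where "g = local_rep (angle_chart \<theta>) (angle_chart \<phi>) f"
  define g' where "g' = local_rep (angle_chart \<theta>') (angle_chart \<phi>') f"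
  define \<delta> where "\<delta> = (\<lambda>s. g' (t' + s) - g (t + s))"
  have opn: "open ?U" "open ?U'"
    using open_angle_chart_local_dom[OF f] by blast+
  have "isCont g t" "isCont g' t'"
    unfolding g_def g'_def using continuous_on_angle_chart_local_rep[OF f] opn t t'
    by (metis continuous_on_eq_continuous_at)+
  then have "isCont (\<lambda>s. g (t + s)) 0" "isCont (\<lambda>s. g' (t' + s)) 0"
    using isCont_o2[of 0 "\<lambda>s. t + s" g] isCont_o2[of 0 "\<lambda>s. t' + s" g'] by simp_all
  then have "isCont \<delta> 0"
    unfolding \<delta>_def by (intro continuous_intros)
  then have close: "\<forall>\<^sub>F s in nhds 0. dist (\<delta> s) (\<delta> 0) < 2 * pi"
    unfolding isCont_def tendsto_at_iff_tendsto_nhds by (rule tendstoD) simp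
  have shift: "((\<lambda>s. a + s) \<longlongrightarrow> a) (nhds 0)" for a :: real
    using tendsto_add[OF tendsto_const filterlim_ident, of a 0] by simp
  have near: "\<forall>\<^sub>F s in nhds 0. t + s \<in> ?U" "\<forall>\<^sub>F s in nhds 0. t' + s \<in> ?U'"
    using topological_tendstoD[OF shift opn(1) t] topological_tendstoD[OF shift opn(2) t'] .
  have cis\<delta>: "cis (\<delta> s) = 1" if "t + s \<in> ?U" "t' + s \<in> ?U'" for s
  proof -
    have "cis (t + s) = cis (t' + s)"
      using eq by (simp flip: cis_mult)
    then have "cis (g' (t' + s)) = cis (g (t + s))"
      using angle_chart_local_rep(2)[OF that(1)] angle_chart_local_rep(2)[OF that(2)]
      unfolding g_def g'_def by simp
    then show ?thesis
      unfolding \<delta>_def by (simp flip: cis_divide)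
  qed
  have "\<forall>\<^sub>F s in nhds 0. g' (t' + s) = g (t + s) + \<delta> 0"
    using close near
  proof eventually_elim
    case (elim s)
    have "cis (\<delta> s - \<delta> 0) = 1"
      using cis\<delta>[of s] cis\<delta>[of 0] elim t t' by (simp flip: cis_divide)
    then have "\<delta> s - \<delta> 0 = 0"
      by (rule cis_eq_1_small) (use elim(1) in \<open>simp add: dist_real_def\<close>)
    then show ?case by (simp add: \<delta>_def)
  qed
  then show ?thesis
    unfolding g_def[symmetric] g'_def[symmetric] by (rule higher_deriv_translate[OF k])
qed

text \<open>The \<open>k\<close>-th derivative of a circle map as a function of the angle, read off in the charts
  centred at the angle and at an angle of the image point.\<close>

definition circle_higher_deriv :: "nat \<Rightarrow> (complex \<Rightarrow> complex) \<Rightarrow> real \<Rightarrow> real" where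
  "circle_higher_deriv k f t =
     (deriv ^^ k) (local_rep (angle_chart t) (angle_chart (Arg (f (cis t)))) f) t"

lemma centred_local_dom:
  assumes "f \<in> circle \<rightarrow> circle"
  shows "t \<in> local_dom (angle_chart t) (angle_chart (Arg (f (cis t)))) f"
proof -
  have n: "norm (f (cis t)) = 1" using assms by (auto simp: Pi_iff)
  then have "f (cis t) \<noteq> 0" by auto
  then have "f (cis t) = cis (Arg (f (cis t)))"
    using n by (simp add: cis_Arg sgn_div_norm)
  then show ?thesis
    by (auto simp: local_dom_def intro!: image_eqI[of _ cis "Arg (f (cis t))"])
qed

lemma circle_higher_deriv_eq:
  assumes "k > 0" "f \<in> circle \<rightarrow> circle" "continuous_on circle f"
    "t \<in> local_dom (angle_chart \<theta>) (angle_chart \<phi>) f"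
  shows "(deriv ^^ k) (local_rep (angle_chart \<theta>) (angle_chart \<phi>) f) t = circle_higher_deriv k f t"
  unfolding circle_higher_deriv_def
  using higher_deriv_angle_chart_independent[OF assms(1-3) centred_local_dom[OF assms(2)] assms(4) refl] .

lemma circle_higher_deriv_cong:
  assumes "k > 0" "f \<in> circle \<rightarrow> circle" "continuous_on circle f" "cis t = cis t'"
  shows "circle_higher_deriv k f t = circle_higher_deriv k f t'"
  unfolding circle_higher_deriv_def
  using higher_deriv_angle_chart_independent[OF assms(1-3) centred_local_dom[OF assms(2)]
      centred_local_dom[OF assms(2)] assms(4)[symmetric]] .

lemma compactly_modelled_cis:
  assumes "\<And>t t'. cis t = cis t' \<Longrightarrow> H t = H t'"
  shows "compactly_modelled H"
  unfolding compactly_modelled_def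
proof (intro exI[of _ pi] allI)
  fix x
  \<comment> \<open>The base point is the principal argument of \<open>cis x\<close>.\<close>
  have "cis (Arg (cis x) + s) = cis (x + s)" for s
    by (simp add: cis_Arg flip: cis_mult)
  then have "H (x + s) = H (Arg (cis x) + s)" for s
    using assms by metis
  moreover have "Arg (cis x) \<in> {-pi..pi}"
    using mpi_less_Arg[of "cis x"] Arg_le_pi[of "cis x"] by simp
  ultimately show "\<exists>y\<in>{-pi..pi}. \<forall>s. \<bar>s\<bar> < 1 \<longrightarrow> H (x + s) = H (y + s)"
    by blast
qed

lemma continuous_on_circle_higher_deriv:
  assumes "k > 0" and f: "Ck_map circle circle_atlas k f"
  shows "continuous_on UNIV (circle_higher_deriv k f)"
proof (rule continuous_at_imp_continuous_on, rule ballI)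
  fix t :: real
  from f have fc: "f \<in> circle \<rightarrow> circle" "continuous_on circle f"
    by (auto simp: Ck_map_def)
  let ?d = "angle_chart (Arg (f (cis t)))"
  let ?U = "local_dom (angle_chart t) ?d f"
  have "angle_chart t \<in> circle_atlas" "?d \<in> circle_atlas"
    by (auto simp: circle_atlas_def)
  then have "continuous_on ?U ((deriv ^^ k) (local_rep (angle_chart t) ?d f))"
    using f unfolding Ck_map_def Ck_on_def by blast
  then have "continuous_on ?U (circle_higher_deriv k f)"
    by (rule continuous_on_eq) (rule circle_higher_deriv_eq[OF assms(1) fc])
  then show "isCont (circle_higher_deriv k f) t"
    using open_angle_chart_local_dom[OF fc] centred_local_dom[OF fc(1)]
    by (metis continuous_on_eq_continuous_at)
qed

lemma Ck_mod_map_circle_iff: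
  assumes "k > 0"
  shows "Ck_mod_map circle circle_atlas k \<alpha> f \<longleftrightarrow>
    Ck_map circle circle_atlas k f \<and>
    locally_modulus_continuous_on \<alpha> UNIV (circle_higher_deriv k f)"
proof (cases "Ck_map circle circle_atlas k f")
  case False
  then show ?thesis
    by (auto simp: Ck_mod_map_def Ck_map_def Ck_mod_on_def)
next
  case True
  then have fc: "f \<in> circle \<rightarrow> circle" "continuous_on circle f"
    by (auto simp: Ck_map_def)
  note eq = circle_higher_deriv_eq[OF assms fc]
  show ?thesis
  proof
    assume L: "Ck_mod_map circle circle_atlas k \<alpha> f"
    have "\<exists>V. open V \<and> t \<in> V \<and> modulus_continuous_on \<alpha> (UNIV \<inter> V) (circle_higher_deriv k f)" for t
    proof -
      let ?d = "angle_chart (Arg (f (cis t)))"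
      let ?U = "local_dom (angle_chart t) ?d f"
      have tU: "t \<in> ?U" by (rule centred_local_dom[OF fc(1)])
      have "angle_chart t \<in> circle_atlas" "?d \<in> circle_atlas"
        by (auto simp: circle_atlas_def)
      then have "locally_modulus_continuous_on \<alpha> ?U ((deriv ^^ k) (local_rep (angle_chart t) ?d f))"
        using L unfolding Ck_mod_map_def Ck_mod_on_def by blast
      then obtain V where V: "open V" "t \<in> V"
        "modulus_continuous_on \<alpha> (?U \<inter> V) ((deriv ^^ k) (local_rep (angle_chart t) ?d f))"
        using tU unfolding locally_modulus_continuous_on_def by blast
      have "modulus_continuous_on \<alpha> (?U \<inter> V) ((deriv ^^ k) (local_rep (angle_chart t) ?d f)) \<longleftrightarrow>
          modulus_continuous_on \<alpha> (?U \<inter> V) (circle_higher_deriv k f)"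
        by (rule modulus_continuous_on_cong) (auto intro: eq)
      with V tU open_angle_chart_local_dom[OF fc, of t "Arg (f (cis t))"] show ?thesis
        by (intro exI[of _ "?U \<inter> V"]) auto
    qed
    with True show "Ck_map circle circle_atlas k f \<and>
      locally_modulus_continuous_on \<alpha> UNIV (circle_higher_deriv k f)"
      unfolding locally_modulus_continuous_on_def by blast
  next
    assume "Ck_map circle circle_atlas k f \<and>
      locally_modulus_continuous_on \<alpha> UNIV (circle_higher_deriv k f)"
    then have R: "locally_modulus_continuous_on \<alpha> UNIV (circle_higher_deriv k f)" ..
    have "locally_modulus_continuous_on \<alpha> (local_dom (angle_chart \<theta>) (angle_chart \<phi>) f)
        ((deriv ^^ k) (local_rep (angle_chart \<theta>) (angle_chart \<phi>) f))" for \<theta> \<phi>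
      unfolding locally_modulus_continuous_on_def
    proof
      let ?U = "local_dom (angle_chart \<theta>) (angle_chart \<phi>) f"
      fix t assume "t \<in> ?U"
      obtain V where V: "open V" "t \<in> V" "modulus_continuous_on \<alpha> V (circle_higher_deriv k f)"
        using R unfolding locally_modulus_continuous_on_def by auto
      have "modulus_continuous_on \<alpha> (?U \<inter> V)
            ((deriv ^^ k) (local_rep (angle_chart \<theta>) (angle_chart \<phi>) f)) \<longleftrightarrow>
          modulus_continuous_on \<alpha> (?U \<inter> V) (circle_higher_deriv k f)"
        by (rule modulus_continuous_on_cong) (auto intro: eq)
      moreover have "modulus_continuous_on \<alpha> (?U \<inter> V) (circle_higher_deriv k f)"
        using V(3) by (rule modulus_continuous_on_subset) auto
      ultimately show "\<exists>V. open V \<and> t \<in> V \<and> modulus_continuous_on \<alpha> (?U \<inter> V)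
          ((deriv ^^ k) (local_rep (angle_chart \<theta>) (angle_chart \<phi>) f))"
        using V by blast
    qed
    with True show "Ck_mod_map circle circle_atlas k \<alpha> f"
      unfolding Ck_mod_map_def Ck_map_def Ck_mod_on_def by (auto simp: circle_atlas_def)
  qed
qed

lemma D_circle_classes:
  assumes "k > 0"
  defines "H \<equiv> \<lambda>f t. (circle_higher_deriv k f t, circle_higher_deriv k (inv_into circle f) t)"
  shows "f \<in> D_circle k \<Longrightarrow> compactly_modelled (H f) \<and> continuous_on UNIV (H f)"
    and "concave_modulus \<alpha> \<Longrightarrow>
      f \<in> D_circle_mod k \<alpha> \<longleftrightarrow> f \<in> D_circle k \<and> locally_modulus_continuous_on \<alpha> UNIV (H f)"
proof -
  assume "f \<in> D_circle k"
  then have f: "Ck_map circle circle_atlas k f" "Ck_map circle circle_atlas k (inv_into circle f)"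
    by (simp_all add: D_circle_def diffeos_def)
  have "H f t = H f t'" if "cis t = cis t'" for t t'
    using f circle_higher_deriv_cong[OF assms(1) _ _ that] unfolding H_def Ck_map_def by blast
  then have "compactly_modelled (H f)"
    by (rule compactly_modelled_cis)
  moreover have "continuous_on UNIV (H f)"
    unfolding H_def using f assms(1)
    by (intro continuous_on_Pair continuous_on_circle_higher_deriv)
  ultimately show "compactly_modelled (H f) \<and> continuous_on UNIV (H f)" ..
next
  assume "concave_modulus \<alpha>"
  then show "f \<in> D_circle_mod k \<alpha> \<longleftrightarrow> f \<in> D_circle k \<and> locally_modulus_continuous_on \<alpha> UNIV (H f)"
    unfolding H_def
    by (auto simp: locally_modulus_continuous_on_Pair D_circle_mod_def D_circle_def diffeos_mod_def
        diffeos_def Ck_mod_map_circle_iff[OF assms(1)])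
qed


section \<open>Unions and intersections of regularity classes\<close>

theorem theorem2p2:
  fixes k :: nat
  assumes "k > 0"
  shows
    "(D_real k = (\<Union>\<beta>\<in>{\<beta>. concave_modulus \<beta>}. D_real_mod k \<beta>) \<and>
      D_real k = (\<Union>\<gamma>\<in>{\<gamma>. concave_modulus \<gamma> \<and> sup_tame \<gamma>}. D_real_mod k \<gamma>) \<and>
      (\<forall>F0. (\<forall>\<mu>\<in>F0. concave_modulus \<mu>) \<longrightarrow>
        (\<exists>F. (\<forall>\<nu>\<in>F. concave_modulus \<nu>) \<and>
          D_real k \<inter> (\<Inter>\<mu>\<in>F0. D_real_mod k \<mu>) = (\<Union>\<nu>\<in>F. D_real_mod k \<nu>)))) \<and>
     (D_circle k = (\<Union>\<beta>\<in>{\<beta>. concave_modulus \<beta>}. D_circle_mod k \<beta>) \<and>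
      D_circle k = (\<Union>\<gamma>\<in>{\<gamma>. concave_modulus \<gamma> \<and> sup_tame \<gamma>}. D_circle_mod k \<gamma>) \<and>
      (\<forall>F0. (\<forall>\<mu>\<in>F0. concave_modulus \<mu>) \<longrightarrow>
        (\<exists>F. (\<forall>\<nu>\<in>F. concave_modulus \<nu>) \<and>
          D_circle k \<inter> (\<Inter>\<mu>\<in>F0. D_circle_mod k \<mu>) = (\<Union>\<nu>\<in>F. D_circle_mod k \<nu>))))"
  using regularity_classes[OF D_real_classes[OF assms]]
    regularity_classes[OF D_circle_classes[OF assms]]
  by (rule conjI)

end
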